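(* Let $\ell_1,\dots,\ell_n:\mathbb{R}^d\to\mathbb{R}$ and $f=\frac1n\sum_{i=1}^n\ell_i$ satisfy Assumptions A and B of the context, and let $\epsilon=\max_{1\le i\le n}\epsilon_i<\infty$, where $\epsilon_i=\sup_{\theta\in\Theta^*}\ell_i(\theta)-\ell_i^*$. Let $\{\theta_k\}_{k\ge0}$ be generated by SGD with random reshuffle with step size $\eta=\frac1L$ from a fixed $\theta_0\in\mathbb{R}^d$. Then for all epochs $B=1,2,\dots$, $$\mathbb{E}\,\mathrm{dist}_{\Theta^*}^2(\theta_{nB})\le \alpha^B\Big(\mathrm{dist}_{\Theta^*}^2(\theta_0)-\frac{2\epsilon\overline M}{L(1-\alpha)}\Big)+\frac{2\epsilon\overline M}{L(1-\alpha)},$$ where $\alpha=\prod_{i=1}^n\big(1-\frac{\mu_i}{L}\big)$ and $$\overline M=\mathbb{E}_\xi\Big[\sum_{k=0}^{n-1}\prod_{s=k+1}^{n-1}\Big(1-\frac{\mu_{\xi(s)}}{L}\Big)\Big],$$ the expectation $\mathbb{E}_\xi$ being over a uniformly random permutation $(\xi(0),\dots,\xi(n-1))$ of $\{1,\dots,n\}$ (an empty product equals $1$).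
   Context: Problem: minimize $f(\theta)=\frac1n\sum_{i=1}^n \ell_i(\theta)$ over $\theta\in\mathbb{R}^d$, where each $\ell_i:\mathbb{R}^d\to\mathbb{R}$ is differentiable. Assumption A (existence): each $\ell_i$ attains its global minimum $\ell_i^*>-\infty$, with nonempty set of global minimizers $\Theta_i^*\subset\mathbb{R}^d$; $f$ attains its global minimum $f^*>-\infty$, with nonempty set of global minimizers $\Theta^*\subset\mathbb{R}^d$. Assumption B: there are constants $L>0$ and $0<\mu_i\le L$ ($i=1,\dots,n$) such that for every $i$: (1) ($L$-smoothness) $\ell_i(x)\le \ell_i(y)+\langle x-y,\nabla\ell_i(y)\rangle+\frac L2\|x-y\|^2$ for all $x,y\in\mathbb{R}^d$; (2) ($\mu_i$-weak strong convexity) $\ell_i(\omega)\ge \ell_i(x)+\langle\omega-x,\nabla\ell_i(x)\rangle+\frac{\mu_i}{2}\|x-\omega\|^2$ for all $x\in\mathbb{R}^d$ and all $\omega\in\mathrm{proj}_{\Theta_i^*}(x)\cup\mathrm{proj}_{\Theta^*}(x)$, where $\mathrm{proj}_A(x)$ is the set of Euclidean projections (nearest points) of $x$ onto $A$. SGD: $\theta_{k+1}=\theta_k-\eta\nabla\ell_{\xi(k)}(\theta_k)$, $k=0,1,\dots$. Random reshuffle: at the start of each epoch (block of $n$ consecutive iterations $nB,\dots,n(B+1)-1$, $B=0,1,\dots$) a uniformly random permutation of $\{1,\dots,n\}$ is drawn (independently across epochs), and $(\xi(nB),\dots,\xi(n(B+1)-1))$ is that permutation; so each index is used exactly once per epoch.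 $\mathbb{E}$ is expectation over these permutations. Distance: $\mathrm{dist}_A(\theta)=\inf_{u\in A}\|\theta-u\|$. *)

theory Defs
  imports "HOL-Analysis.Analysis" "HOL-Probability.Probability"
begin

text \<open>
  The component losses are indexed by \<open>{..<n}\<close> instead of \<open>{1..n}\<close>: only the values \<open>l i\<close> and
  \<open>\<mu> i\<close> with \<open>i < n\<close> matter.
\<close>

definition grad :: "('a::real_inner \<Rightarrow> real) \<Rightarrow> 'a \<Rightarrow> 'a" where
  "grad g x = (THE D. GDERIV g x :> D)"

lemma grad_eqI:
  assumes "GDERIV g x :> D"
  shows "grad g x = D"
proof -
  have "D' = D" if "GDERIV g x :> D'" for D'
  proof -
    have "(\<lambda>h. inner h D') = (\<lambda>h. inner h D)"
      using has_derivative_unique assms that unfolding gderiv_def by blast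
    then show ?thesis
      by (metis vector_eq_ldot)
  qed
  then show ?thesis
    unfolding grad_def using assms by blast
qed

lemma gderiv_grad:
  fixes g :: "'a::euclidean_space \<Rightarrow> real"
  assumes "g differentiable (at x)"
  shows "GDERIV g x :> grad g x"
proof -
  obtain g' where g': "(g has_derivative g') (at x)"
    using assms unfolding differentiable_def by blast
  then have "linear g'"
    by (rule has_derivative_linear)
  then have "g' = (\<lambda>h. inner h (adjoint g' 1))"
    using adjoint_works by fastforce
  with g' have "GDERIV g x :> adjoint g' 1"
    unfolding gderiv_def by simp
  with grad_eqI show ?thesis
    by metis
qed

definition objective :: "nat \<Rightarrow> (nat \<Rightarrow> 'a \<Rightarrow> real) \<Rightarrow> 'a \<Rightarrow> real" where
  "objective n l \<theta> = (1 / real n) * (\<Sum>i<n. l i \<theta>)"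

definition minimizers :: "('a \<Rightarrow> real) \<Rightarrow> 'a set" where
  "minimizers g = {x. \<forall>y. g x \<le> g y}"

definition nearest_points :: "'a::metric_space set \<Rightarrow> 'a \<Rightarrow> 'a set" where
  "nearest_points A x = {u \<in> A. \<forall>v\<in>A. dist x u \<le> dist x v}"

definition L_smooth :: "real \<Rightarrow> ('a::real_inner \<Rightarrow> real) \<Rightarrow> bool" where
  "L_smooth L g \<longleftrightarrow>
     (\<forall>x y. g x \<le> g y + inner (x - y) (grad g y) + L / 2 * (norm (x - y))\<^sup>2)"

definition weakly_strongly_convex ::
    "real \<Rightarrow> 'a set \<Rightarrow> ('a::real_inner \<Rightarrow> real) \<Rightarrow> bool" where
  "weakly_strongly_convex m S g \<longleftrightarrow>
     (\<forall>x. \<forall>w \<in> nearest_points (minimizers g) x \<union> nearest_points S x.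
        g w \<ge> g x + inner (w - x) (grad g x) + m / 2 * (norm (x - w))\<^sup>2)"

text \<open>
  The suprema, infima and maximum below are the intended ones when the sets of values are
  nonempty and bounded on the relevant side (and \<open>n \<ge> 1\<close>).
\<close>

definition gap :: "'a set \<Rightarrow> ('a \<Rightarrow> real) \<Rightarrow> real" where
  "gap S g = (SUP \<theta>\<in>S. g \<theta>) - (INF x. g x)"

definition max_gap :: "nat \<Rightarrow> (nat \<Rightarrow> 'a \<Rightarrow> real) \<Rightarrow> real" where
  "max_gap n l = (MAX i\<in>{..<n}. gap (minimizers (objective n l)) (l i))"

primrec sgd ::
    "(nat \<Rightarrow> 'a::real_inner \<Rightarrow> real) \<Rightarrow> real \<Rightarrow> (nat \<Rightarrow> nat) \<Rightarrow> 'a \<Rightarrow> nat \<Rightarrow> 'a" where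
  "sgd l \<eta> \<xi> \<theta>0 0 = \<theta>0"
| "sgd l \<eta> \<xi> \<theta>0 (Suc k) =
     sgd l \<eta> \<xi> \<theta>0 k - \<eta> *\<^sub>R grad (l (\<xi> k)) (sgd l \<eta> \<xi> \<theta>0 k)"

definition perms :: "nat \<Rightarrow> (nat \<Rightarrow> nat) set" where
  "perms n = {\<pi>. \<pi> permutes {..<n}}"

text \<open>\<open>\<sigma> b\<close> is the random permutation drawn at the start of epoch \<open>b = 0, 1, \<dots>\<close>.\<close>

definition random_reshuffle :: "'w measure \<Rightarrow> nat \<Rightarrow> (nat \<Rightarrow> 'w \<Rightarrow> nat \<Rightarrow> nat) \<Rightarrow> bool" where
  "random_reshuffle P n \<sigma> \<longleftrightarrow>
     prob_space P \<and>
     prob_space.indep_vars P (\<lambda>b. count_space (perms n)) \<sigma> UNIV \<and>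
     (\<forall>b. distr P (count_space (perms n)) (\<sigma> b) = uniform_count_measure (perms n))"

definition reshuffled_index :: "nat \<Rightarrow> (nat \<Rightarrow> 'w \<Rightarrow> nat \<Rightarrow> nat) \<Rightarrow> 'w \<Rightarrow> nat \<Rightarrow> nat" where
  "reshuffled_index n \<sigma> \<omega> k = \<sigma> (k div n) \<omega> (k mod n)"

definition epoch_rate :: "nat \<Rightarrow> real \<Rightarrow> (nat \<Rightarrow> real) \<Rightarrow> real" where
  "epoch_rate n L \<mu> = (\<Prod>i<n. 1 - \<mu> i / L)"

definition mean_epoch_weight :: "nat \<Rightarrow> real \<Rightarrow> (nat \<Rightarrow> real) \<Rightarrow> real" where
  "mean_epoch_weight n L \<mu> =
     (\<integral>\<pi>. (\<Sum>k<n. \<Prod>s\<in>{k + 1..<n}. 1 - \<mu> (\<pi> s) / L) \<partial>uniform_count_measure (perms n))"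

end

theory Submission
  imports Defs
begin

text \<open>
  The argument is pathwise; the expectation is taken only once, at the end.

  A gradient step of length \<open>1 / L\<close> decreases an \<open>L\<close>-smooth loss \<open>g\<close> by at least
  \<open>\<bar>\<nabla>g\<bar>\<^sup>2 / (2 L)\<close>, so \<open>\<bar>\<nabla>g x\<bar>\<^sup>2\<close> is at most \<open>2 L (g x - inf g)\<close>. Expanding the square of the
  distance from the new iterate to the point \<open>w\<close> of the set \<open>\<Theta>\<close> of global minimizers nearest to
  the old one, weak strong convexity
  bounds the cross term by \<open>g w - g x\<close> and a multiple of the old squared distance. The two
  occurrences of \<open>g x\<close> cancel, which is what the step size \<open>1 / L\<close> achieves, and what remains
  (\<open>step_infdist_bound\<close>) is a contraction by \<open>1 - m / L\<close> up to the error \<open>(2 / L) (g w - inf g)\<close>,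
  hence at most \<open>2 \<epsilon> / L\<close>.

  Unrolling this affine recursion over an epoch gives the factor \<open>\<alpha>\<close>, the same for every
  order since an epoch uses each index once, and an error that is \<open>2 \<epsilon> / L\<close> times a weight
  depending only on the permutation of that epoch (\<open>epoch_infdist_bound\<close>). Unrolling over the
  epochs bounds the squared distance by a linear combination of these weights, with
  deterministic coefficients. Each weight has expectation \<open>M\<close> as each permutation is uniform,
  and the geometric series in \<open>\<alpha>\<close> yields the claim.
\<close>

text \<open>The unrolled form of an affine recursion; it serves both inside an epoch and across epochs.\<close>

lemma affine_recursion_bound:
  fixes a r c :: "nat \<Rightarrow> real"
  assumes "\<And>k. k < N \<Longrightarrow> 0 \<le> r k"
    and "\<And>k. k < N \<Longrightarrow> a (Suc k) \<le> r k * a k + c k"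
  shows "a N \<le> (\<Prod>k<N. r k) * a 0 + (\<Sum>k<N. (\<Prod>s\<in>{k + 1..<N}. r s) * c k)"
  using assms
proof (induction N)
  case 0
  then show ?case by simp
next
  case (Suc N)
  have IH: "a N \<le> (\<Prod>k<N. r k) * a 0 + (\<Sum>k<N. (\<Prod>s\<in>{k + 1..<N}. r s) * c k)"
    using Suc by simp
  have shift: "(\<Sum>k<N. (\<Prod>s\<in>{k + 1..<Suc N}. r s) * c k)
      = r N * (\<Sum>k<N. (\<Prod>s\<in>{k + 1..<N}. r s) * c k)"
    unfolding sum_distrib_left by (rule sum.cong) (simp_all add: prod.atLeastLessThan_Suc)
  have "a (Suc N) \<le> r N * a N + c N"
    using Suc.prems by simp
  also have "\<dots> \<le> r N * ((\<Prod>k<N. r k) * a 0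
      + (\<Sum>k<N. (\<Prod>s\<in>{k + 1..<N}. r s) * c k)) + c N"
    using mult_left_mono[OF IH, of "r N"] Suc.prems(1)[of N] by simp
  also have "\<dots> = (\<Prod>k<Suc N. r k) * a 0
      + (\<Sum>k<Suc N. (\<Prod>s\<in>{k + 1..<Suc N}. r s) * c k)"
    using shift by (simp add: algebra_simps)
  finally show ?case .
qed

section \<open>One gradient step\<close>

lemma closed_minimizers:
  fixes g :: "'a::topological_space \<Rightarrow> real"
  assumes "continuous_on UNIV g"
  shows "closed (minimizers g)"
proof -
  have "minimizers g = (\<Inter>y. {x. g x \<le> g y})"
    by (auto simp: minimizers_def)
  then show ?thesis
    using assms by (auto intro!: closed_INT closed_Collect_le)
qed

lemma obtain_nearest_point:
  fixes S :: "'a::heine_borel set"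
  assumes "closed S" "S \<noteq> {}"
  obtains w where "w \<in> nearest_points S x" "w \<in> S" "infdist x S = dist x w"
proof -
  obtain w where w: "w \<in> S" "infdist x S = dist x w"
    using infdist_attains_inf[OF assms] by blast
  then have "w \<in> nearest_points S x"
    unfolding nearest_points_def using infdist_le[of _ S x] by auto
  with w that show thesis by blast
qed

lemma bdd_below_of_minimizers:
  assumes "minimizers g \<noteq> {}"
  shows "bdd_below (range g)"
  using assms by (auto simp: minimizers_def bdd_below_def)

text \<open>The infimum of the loss lies below its value after a step of length \<open>1 / L\<close>.\<close>

lemma grad_norm_bound:
  fixes g :: "'a::real_inner \<Rightarrow> real"
  assumes "L_smooth L g" "L > 0" "bdd_below (range g)"
  shows "(norm (grad g x))\<^sup>2 \<le> 2 * L * (g x - (INF y. g y))"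
proof -
  define D where "D = grad g x"
  have "(INF y. g y) \<le> g (x - (1 / L) *\<^sub>R D)"
    using assms(3) by (intro cINF_lower) auto
  also have "\<dots> \<le> g x + inner ((x - (1 / L) *\<^sub>R D) - x) D
      + L / 2 * (norm ((x - (1 / L) *\<^sub>R D) - x))\<^sup>2"
    using assms(1) unfolding L_smooth_def D_def by blast
  also have "\<dots> = g x - (norm D)\<^sup>2 / (2 * L)"
    using assms(2)
    by (simp add: power_divide power2_norm_eq_inner[symmetric] field_simps power2_eq_square)
  finally show ?thesis
    using assms(2) unfolding D_def by (simp add: field_simps)
qed

text \<open>
  The proof only compares with the nearest point \<open>w\<close> of the old iterate; the new iterate may have
  a nearer one, so the bound is an inequality. The supremum in \<open>gap\<close> absorbs the dependence of
  the error on \<open>w\<close>.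
\<close>

lemma step_infdist_bound:
  fixes g :: "'a::euclidean_space \<Rightarrow> real"
  assumes "closed S" "S \<noteq> {}" and L: "L > 0" and "L_smooth L g"
    and wsc: "weakly_strongly_convex m S g"
    and bdd: "bdd_below (range g)" "bdd_above (g ` S)"
  shows "(infdist (x - (1 / L) *\<^sub>R grad g x) S)\<^sup>2
    \<le> (1 - m / L) * (infdist x S)\<^sup>2 + 2 * gap S g / L"
proof -
  obtain w where w: "w \<in> nearest_points S x" "w \<in> S" "infdist x S = dist x w"
    using obtain_nearest_point assms(1,2) by blast
  define D where "D = grad g x"
  define y where "y = x - (1 / L) *\<^sub>R D"
  have convex: "g w \<ge> g x + inner (w - x) D + m / 2 * (norm (x - w))\<^sup>2"
    using wsc w(1) unfolding weakly_strongly_convex_def D_def by blast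
  have smooth: "(norm D)\<^sup>2 \<le> 2 * L * (g x - (INF y. g y))"
    unfolding D_def by (rule grad_norm_bound) fact+
  have "g w \<le> (SUP \<theta>\<in>S. g \<theta>)"
    using bdd(2) w(2) by (intro cSUP_upper)
  then have err: "g w - (INF y. g y) \<le> gap S g"
    by (simp add: gap_def)
  have "infdist y S \<le> dist y w"
    using w(2) by (rule infdist_le)
  then have "(infdist y S)\<^sup>2 \<le> (norm (y - w))\<^sup>2"
    by (simp add: dist_norm infdist_nonneg power_mono)
  also have "\<dots> = (norm (x - w))\<^sup>2 + (2 / L) * inner (w - x) D + (norm D)\<^sup>2 / L\<^sup>2"
  proof -
    have split: "y - w = (x - w) - (1 / L) *\<^sub>R D"
      by (simp add: y_def)
    show ?thesis
      unfolding split power2_norm_eq_inner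
      by (simp add: inner_diff_left inner_diff_right inner_commute algebra_simps power2_eq_square)
  qed
  also have "\<dots> \<le> (norm (x - w))\<^sup>2 + (2 / L) * (g w - g x - m / 2 * (norm (x - w))\<^sup>2)
      + 2 * L * (g x - (INF y. g y)) / L\<^sup>2"
    using L convex smooth by (intro add_mono mult_left_mono divide_right_mono) auto
  also have "\<dots> = (1 - m / L) * (norm (x - w))\<^sup>2 + 2 * (g w - (INF y. g y)) / L"
    using L by (simp add: field_simps power2_eq_square)
  also have "\<dots> \<le> (1 - m / L) * (norm (x - w))\<^sup>2 + 2 * gap S g / L"
    using L err by (intro add_left_mono divide_right_mono) auto
  finally show ?thesis
    using w(3) by (simp add: y_def D_def dist_norm)
qed

section \<open>Epochs and their weights\<close>

definition epoch_weight :: "nat \<Rightarrow> real \<Rightarrow> (nat \<Rightarrow> real) \<Rightarrow> (nat \<Rightarrow> nat) \<Rightarrow> real" where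
  "epoch_weight n L \<mu> \<pi> = (\<Sum>k<n. \<Prod>s\<in>{k + 1..<n}. 1 - \<mu> (\<pi> s) / L)"

lemma epoch_rate_bounds:
  assumes "n \<ge> 1" "L > 0" "\<And>i. i < n \<Longrightarrow> 0 < \<mu> i \<and> \<mu> i \<le> L"
  shows "0 \<le> epoch_rate n L \<mu>" "epoch_rate n L \<mu> < 1"
proof -
  have r: "0 \<le> 1 - \<mu> i / L" "1 - \<mu> i / L < 1" if "i < n" for i
    using assms(2) assms(3)[OF that] by (simp_all add: field_simps)
  then show "0 \<le> epoch_rate n L \<mu>"
    unfolding epoch_rate_def by (intro prod_nonneg) auto
  have "epoch_rate n L \<mu> = (1 - \<mu> 0 / L) * (\<Prod>i\<in>{..<n} - {0}. 1 - \<mu> i / L)"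
    unfolding epoch_rate_def using assms(1) by (intro prod.remove) auto
  also have "\<dots> \<le> (1 - \<mu> 0 / L) * 1"
    using r assms(1) by (intro mult_left_mono prod_le_1) (auto intro: less_imp_le)
  also have "\<dots> < 1"
    using r assms(1) by simp
  finally show "epoch_rate n L \<mu> < 1" .
qed

lemma epoch_weight_nonneg:
  assumes "L > 0" "\<And>i. i < n \<Longrightarrow> \<mu> i \<le> L" "\<pi> \<in> perms n"
  shows "0 \<le> epoch_weight n L \<mu> \<pi>"
proof -
  have "0 \<le> 1 - \<mu> (\<pi> s) / L" if "s < n" for s
    using assms permutes_in_image[of \<pi> "{..<n}" s] that by (simp add: perms_def)
  then show ?thesis
    unfolding epoch_weight_def by (intro sum_nonneg prod_nonneg) auto
qed

text \<open>
  The product of the contraction factors is symmetric in the indices, so it does not see the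
  order \<open>\<pi>\<close> in which the epoch visits them; the accumulated error does.
\<close>

lemma epoch_infdist_bound:
  fixes l :: "nat \<Rightarrow> 'a::euclidean_space \<Rightarrow> real"
  assumes "closed S" "S \<noteq> {}" "L > 0"
    and \<mu>: "\<And>i. i < n \<Longrightarrow> \<mu> i \<le> L"
    and "\<And>i. i < n \<Longrightarrow> L_smooth L (l i)"
    and "\<And>i. i < n \<Longrightarrow> weakly_strongly_convex (\<mu> i) S (l i)"
    and "\<And>i. i < n \<Longrightarrow> bdd_below (range (l i))"
    and "\<And>i. i < n \<Longrightarrow> bdd_above (l i ` S)"
    and gap: "\<And>i. i < n \<Longrightarrow> gap S (l i) \<le> \<epsilon>"
    and \<pi>: "\<pi> \<in> perms n" and \<xi>: "\<And>k. k < n \<Longrightarrow> \<xi> (N + k) = \<pi> k"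
  shows "(infdist (sgd l (1 / L) \<xi> \<theta> (N + n)) S)\<^sup>2
    \<le> epoch_rate n L \<mu> * (infdist (sgd l (1 / L) \<xi> \<theta> N) S)\<^sup>2
      + 2 * \<epsilon> / L * epoch_weight n L \<mu> \<pi>"
proof -
  have perm: "\<pi> permutes {..<n}"
    using \<pi> by (simp add: perms_def)
  then have idx: "\<pi> k < n" if "k < n" for k
    using permutes_in_image[of \<pi> "{..<n}" k] that by simp
  define a where "a k = (infdist (sgd l (1 / L) \<xi> \<theta> (N + k)) S)\<^sup>2" for k
  define r where "r k = 1 - \<mu> (\<pi> k) / L" for k
  have r0: "0 \<le> r k" if "k < n" for k
    using \<mu>[OF idx[OF that]] \<open>L > 0\<close> by (simp add: r_def)
  have step: "a (Suc k) \<le> r k * a k + 2 * \<epsilon> / L" if "k < n" for k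
  proof -
    define x where "x = sgd l (1 / L) \<xi> \<theta> (N + k)"
    have "a (Suc k) = (infdist (x - (1 / L) *\<^sub>R grad (l (\<pi> k)) x) S)\<^sup>2"
      using \<xi>[OF that] by (simp add: a_def x_def)
    also have "\<dots> \<le> r k * a k + 2 * gap S (l (\<pi> k)) / L"
      unfolding r_def a_def x_def using idx[OF that] assms(1-8)
      by (intro step_infdist_bound) auto
    also have "\<dots> \<le> r k * a k + 2 * \<epsilon> / L"
      using gap[OF idx[OF that]] \<open>L > 0\<close> by (simp add: divide_right_mono)
    finally show ?thesis .
  qed
  have "a n \<le> (\<Prod>k<n. r k) * a 0 + (\<Sum>k<n. (\<Prod>s\<in>{k + 1..<n}. r s) * (2 * \<epsilon> / L))"
    using r0 step by (intro affine_recursion_bound)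
  moreover have "(\<Prod>k<n. r k) = epoch_rate n L \<mu>"
    unfolding epoch_rate_def r_def
    using prod.permute[OF perm, of "\<lambda>i. 1 - \<mu> i / L"] by (simp add: o_def)
  ultimately show ?thesis
    by (simp add: a_def epoch_weight_def r_def sum_distrib_left mult.commute)
qed

lemma reshuffled_index_epoch:
  assumes "k < n"
  shows "reshuffled_index n \<sigma> \<omega> (n * b + k) = \<sigma> b \<omega> k"
  using assms by (simp add: reshuffled_index_def)

section \<open>Random permutations\<close>

lemma finite_perms: "finite (perms n)"
  unfolding perms_def by (rule finite_permutations) simp

lemma random_reshuffle_measurable:
  assumes "random_reshuffle P n \<sigma>"
  shows "\<sigma> b \<in> measurable P (count_space (perms n))"
  using assms unfolding random_reshuffle_def
  by (auto simp: prob_space.indep_vars_def2)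

lemma expectation_of_permutation:
  fixes h :: "(nat \<Rightarrow> nat) \<Rightarrow> real"
  assumes "random_reshuffle P n \<sigma>"
  shows "integrable P (\<lambda>\<omega>. h (\<sigma> b \<omega>))"
    and "(\<integral>\<omega>. h (\<sigma> b \<omega>) \<partial>P) = (\<integral>\<pi>. h \<pi> \<partial>uniform_count_measure (perms n))"
proof -
  have meas: "\<sigma> b \<in> measurable P (count_space (perms n))"
    using assms by (rule random_reshuffle_measurable)
  have distr: "distr P (count_space (perms n)) (\<sigma> b) = uniform_count_measure (perms n)"
    using assms by (simp add: random_reshuffle_def)
  have "integrable (uniform_count_measure (perms n)) h"
    unfolding uniform_count_measure_def
    by (rule integrable_point_measure_finite) (rule finite_perms)
  then show "integrable P (\<lambda>\<omega>. h (\<sigma> b \<omega>))"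
    unfolding distr[symmetric] using meas by (subst (asm) integrable_distr_eq) auto
  show "(\<integral>\<omega>. h (\<sigma> b \<omega>) \<partial>P) = (\<integral>\<pi>. h \<pi> \<partial>uniform_count_measure (perms n))"
    unfolding distr[symmetric] using meas by (subst integral_distr) auto
qed

section \<open>Convergence of random reshuffling\<close>

theorem theorem3:
  fixes n :: nat
    and l :: "nat \<Rightarrow> real ^ 'd \<Rightarrow> real"
    and L :: real
    and \<mu> :: "nat \<Rightarrow> real"
    and P :: "'w measure"
    and \<sigma> :: "nat \<Rightarrow> 'w \<Rightarrow> nat \<Rightarrow> nat"
    and \<theta>0 :: "real ^ 'd"
    and B :: nat
  defines "\<Theta> \<equiv> minimizers (objective n l)"
    and "\<epsilon> \<equiv> max_gap n l"
    and "\<alpha> \<equiv> epoch_rate n L \<mu>"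
    and "M \<equiv> mean_epoch_weight n L \<mu>"
  assumes "n \<ge> 1"
    and "\<And>i x. i < n \<Longrightarrow> l i differentiable (at x)"
    and "\<And>i. i < n \<Longrightarrow> minimizers (l i) \<noteq> {}"
    and "\<Theta> \<noteq> {}"
    and "L > 0"
    and "\<And>i. i < n \<Longrightarrow> 0 < \<mu> i \<and> \<mu> i \<le> L"
    and "\<And>i. i < n \<Longrightarrow> L_smooth L (l i)"
    and "\<And>i. i < n \<Longrightarrow> weakly_strongly_convex (\<mu> i) \<Theta> (l i)"
    and "\<And>i. i < n \<Longrightarrow> bdd_above (l i ` \<Theta>)"
    and "random_reshuffle P n \<sigma>"
    and "B \<ge> 1"
  shows "(\<integral>\<omega>. (infdist (sgd l (1 / L) (reshuffled_index n \<sigma> \<omega>) \<theta>0 (n * B)) \<Theta>)\<^sup>2 \<partial>P)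
       \<le> \<alpha> ^ B * ((infdist \<theta>0 \<Theta>)\<^sup>2 - 2 * \<epsilon> * M / (L * (1 - \<alpha>)))
         + 2 * \<epsilon> * M / (L * (1 - \<alpha>))"
proof -
  note n = assms(5) and diff = assms(6) and L = assms(9) and \<mu> = assms(10)
    and reshuffle = assms(14)
  interpret prob_space P
    using reshuffle by (simp add: random_reshuffle_def)
  have "continuous_on UNIV (l i)" if "i < n" for i
    using diff[OF that] differentiable_imp_continuous_within
    by (auto simp: continuous_on_eq_continuous_within)
  then have "continuous_on UNIV (objective n l)"
    unfolding objective_def by (intro continuous_intros) auto
  then have closed: "closed \<Theta>"
    unfolding \<Theta>_def by (rule closed_minimizers)
  have below: "bdd_below (range (l i))" if "i < n" for i
    using assms(7)[OF that] by (rule bdd_below_of_minimizers)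
  have gap_le: "gap \<Theta> (l i) \<le> \<epsilon>" if "i < n" for i
    unfolding \<epsilon>_def max_gap_def \<Theta>_def[symmetric] using that by (intro Max_ge) auto
  have \<epsilon>: "0 \<le> \<epsilon>"
  proof -
    obtain w where "w \<in> \<Theta>"
      using \<open>\<Theta> \<noteq> {}\<close> by blast
    then have "(INF x. l 0 x) \<le> l 0 w" "l 0 w \<le> (SUP \<theta>\<in>\<Theta>. l 0 \<theta>)"
      using below[of 0] assms(13)[of 0] n by (auto intro!: cINF_lower cSUP_upper)
    then show ?thesis
      using gap_le[of 0] n by (simp add: gap_def)
  qed
  have \<alpha>: "0 \<le> \<alpha>" "\<alpha> < 1"
    unfolding \<alpha>_def using epoch_rate_bounds[OF n L \<mu>] by auto
  define d where "d \<omega> b = (infdist (sgd l (1 / L) (reshuffled_index n \<sigma> \<omega>) \<theta>0 (n * b)) \<Theta>)\<^sup>2"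
    for \<omega> b
  define W where "W b \<omega> = epoch_weight n L \<mu> (\<sigma> b \<omega>)" for b \<omega>
  define bound where "bound \<omega> = \<alpha> ^ B * (infdist \<theta>0 \<Theta>)\<^sup>2
    + (\<Sum>b<B. \<alpha> ^ (B - Suc b) * (2 * \<epsilon> / L * W b \<omega>))" for \<omega>
  have perm: "\<sigma> b \<omega> \<in> perms n" if "\<omega> \<in> space P" for b \<omega>
    using measurable_space[OF random_reshuffle_measurable[OF reshuffle] that] by simp
  have epoch: "d \<omega> (Suc b) \<le> \<alpha> * d \<omega> b + 2 * \<epsilon> / L * W b \<omega>" if "\<omega> \<in> space P" for \<omega> b
  proof -
    have "n * Suc b = n * b + n"
      by simp
    then show ?thesis
      unfolding d_def W_def \<alpha>_def
      using closed \<open>\<Theta> \<noteq> {}\<close> L \<mu> assms(11-13) below gap_le perm[OF that]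
      by (simp only:) (intro epoch_infdist_bound reshuffled_index_epoch; simp)
  qed
  have pathwise: "d \<omega> B \<le> bound \<omega>" if "\<omega> \<in> space P" for \<omega>
  proof -
    have "d \<omega> B \<le> (\<Prod>b<B. \<alpha>) * d \<omega> 0
        + (\<Sum>b<B. (\<Prod>s\<in>{b + 1..<B}. \<alpha>) * (2 * \<epsilon> / L * W b \<omega>))"
      using \<alpha> epoch[OF that] by (intro affine_recursion_bound)
    then show ?thesis
      by (simp add: bound_def d_def)
  qed
  have W0: "0 \<le> W b \<omega>" if "\<omega> \<in> space P" for b \<omega>
    unfolding W_def using L \<mu> perm[OF that] by (intro epoch_weight_nonneg) auto
  have W_int: "integrable P (W b)" and W_mean: "(\<integral>\<omega>. W b \<omega> \<partial>P) = M" for b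
    using expectation_of_permutation[OF reshuffle, of "epoch_weight n L \<mu>" b]
    unfolding W_def[abs_def] M_def mean_epoch_weight_def epoch_weight_def by auto
  have bound_int: "integrable P bound"
    unfolding bound_def using W_int by (intro Bochner_Integration.integrable_add Bochner_Integration.integrable_sum) auto
  have "(\<integral>\<omega>. d \<omega> B \<partial>P) \<le> (\<integral>\<omega>. bound \<omega> \<partial>P)"
  proof (rule integral_mono'[OF bound_int pathwise])
    \<comment> \<open>If \<open>d\<close> were not integrable, its integral would have the default value \<open>0\<close>, so a nonnegative
      majorant covers both cases.\<close>
    show "0 \<le> bound \<omega>" if "\<omega> \<in> space P" for \<omega>
      unfolding bound_def using \<alpha> \<epsilon> L W0[OF that] by (intro add_nonneg_nonneg sum_nonneg) auto
  qed
  also have "\<dots> = \<alpha> ^ B * (infdist \<theta>0 \<Theta>)\<^sup>2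
      + (\<Sum>b<B. \<alpha> ^ (B - Suc b) * (2 * \<epsilon> / L * M))"
    unfolding bound_def using W_int by (simp add: W_mean prob_space)
  also have "(\<Sum>b<B. \<alpha> ^ (B - Suc b) * (2 * \<epsilon> / L * M))
      = (\<Sum>b<B. \<alpha> ^ b) * (2 * \<epsilon> / L * M)"
    unfolding sum_distrib_right[symmetric]
    using sum.nat_diff_reindex[of "\<lambda>b. \<alpha> ^ b" B] by simp
  also have "(\<Sum>b<B. \<alpha> ^ b) = (1 - \<alpha> ^ B) / (1 - \<alpha>)"
    using \<alpha> by (simp add: sum_gp_strict)
  also have "\<alpha> ^ B * (infdist \<theta>0 \<Theta>)\<^sup>2 + (1 - \<alpha> ^ B) / (1 - \<alpha>) * (2 * \<epsilon> / L * M)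
      = \<alpha> ^ B * ((infdist \<theta>0 \<Theta>)\<^sup>2 - 2 * \<epsilon> * M / (L * (1 - \<alpha>)))
        + 2 * \<epsilon> * M / (L * (1 - \<alpha>))"
    by (simp add: algebra_simps diff_divide_distrib)
  finally show ?thesis
    by (simp add: d_def)
qed

end
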